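(* For every real $x$ with $0<x<\pi/2$, \begin{align*} 2+\left(\frac{8}{45}-\frac{8}{945}x^2+ax^{4}\right)x^{3}\tan x&<\left(\frac{\sin x}{x}\right)^{2}+\frac{\tan x}{x}\\ &<2+\left(\frac{8}{45}-\frac{8}{945}x^2+bx^{4}\right)x^{3}\tan x \end{align*} with the best possible constants $$a=\frac{16}{14175}=0.001128\ldots\quad\text{and}\quad b=\frac{241920-2688\pi^4+32\pi^6}{945\pi^8}=0.001209\ldots.$$
   Context: "Best possible constants" means that the inequalities hold for all $x\in(0,\pi/2)$ with the given constants, and that the left-hand inequality fails for some $x\in(0,\pi/2)$ if $a$ is replaced by any larger real number, while the right-hand inequality fails for some $x\in(0,\pi/2)$ if $b$ is replaced by any smaller real number. *)

theory Defs
  imports Complex_Main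
begin

definition wilker :: "real \<Rightarrow> real" where
  "wilker x = (sin x / x)\<^sup>2 + tan x / x"

definition wilker_bound :: "real \<Rightarrow> real \<Rightarrow> real" where
  "wilker_bound c x = 2 + (8 / 45 - 8 / 945 * x\<^sup>2 + c * x ^ 4) * x ^ 3 * tan x"

definition best_lower_constant :: "real \<Rightarrow> bool" where
  "best_lower_constant a \<longleftrightarrow>
     (\<forall>x\<in>{0<..<pi / 2}. wilker_bound a x < wilker x) \<and>
     (\<forall>a'>a. \<exists>x\<in>{0<..<pi / 2}. \<not> wilker_bound a' x < wilker x)"

definition best_upper_constant :: "real \<Rightarrow> bool" where
  "best_upper_constant b \<longleftrightarrow>
     (\<forall>x\<in>{0<..<pi / 2}. wilker x < wilker_bound b x) \<and>
     (\<forall>b'<b. \<exists>x\<in>{0<..<pi / 2}. \<not> wilker x < wilker_bound b' x)"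

end

theory Submission
  imports Defs "HOL-Analysis.Gamma_Function" "HOL-Real_Asymp.Real_Asymp"
begin

text \<open>
  Subtracting the bound with constant \<open>c\<close> from the Wilker expression leaves
  \<open>x ^ 7 * tan x * (g x - c)\<close>, where \<open>g\<close> does not involve \<open>c\<close>. So the best constants are the
  infimum and the supremum of \<open>g\<close> on \<open>(0, pi / 2)\<close>, and once \<open>g\<close> is known to be strictly increasing
  these are its limits at the two ends.

  For the monotonicity, the partial fraction expansion of the cotangent (the logarithmic
  derivative of the Gamma reflection formula) turns the cotangent part of \<open>g\<close> into
  \<open>4 * (\<Sum>n\<ge>1. 1 / (N ^ 3 * (N - x\<^sup>2)))\<close> with \<open>N = (n * pi)\<^sup>2\<close>. As a function of \<open>x\<^sup>2\<close> its slope is at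
  least \<open>4 / pi ^ 10\<close>, already from the term \<open>n = 1\<close>. The rest of \<open>g\<close> is a scaled Taylor remainder of
  the sine, which decreases with slope at most \<open>2 ^ 10 / 11!\<close>, and this is smaller.
\<close>

text \<open>The squares of the positive poles of the cotangent, indexed from 0.\<close>

definition pole :: "nat \<Rightarrow> real" where
  "pole n = (pi * (real n + 1))\<^sup>2"

text \<open>The tail from order \<open>k\<close> on of the power series of
  \<open>pole_sum 0 y\<close> in \<open>y\<close>, divided by \<open>y ^ k\<close>.\<close>

definition pole_sum :: "nat \<Rightarrow> real \<Rightarrow> real" where
  "pole_sum k y = (\<Sum>n. 1 / (pole n ^ k * (pole n - y)))"

section \<open>Reflection formulas for Gamma and Digamma\<close>

lemma Gamma_reflection_real:
  assumes "0 < z" "z < 1"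
  shows "Gamma z * Gamma (1 - z) = pi / sin (pi * z)"
proof -
  have "complex_of_real (Gamma z * Gamma (1 - z)) = Gamma (of_real z) * Gamma (1 - of_real z)"
    using Gamma_complex_of_real[of z] Gamma_complex_of_real[of "1 - z"] by simp
  also have "\<dots> = of_real (pi / sin (pi * z))"
    by (simp add: Gamma_reflection_complex flip: sin_of_real)
  finally show ?thesis
    by (simp only: of_real_eq_iff)
qed

text \<open>The product rule and the closed form \<open>pi / sin (pi * z)\<close> give two
  derivatives of the same function, which must agree.\<close>

lemma Digamma_reflection_real:
  assumes z: "0 < z" "z < 1"
  shows "Digamma (1 - z) - Digamma z = pi * cot (pi * z)"
proof -
  have sin_pos: "sin (pi * z) > 0"
    using z by (intro sin_gt_zero) auto
  have nonpole: "z \<notin> \<int>\<^sub>\<le>\<^sub>0" "1 - z \<notin> \<int>\<^sub>\<le>\<^sub>0"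
    using z by (auto elim!: nonpos_Ints_cases)
  have "((\<lambda>z. Gamma z * Gamma (1 - z)) has_real_derivative
          Gamma z * Gamma (1 - z) * (Digamma z - Digamma (1 - z))) (at z)"
    using nonpole by (auto intro!: derivative_eq_intros simp: algebra_simps)
  moreover have "((\<lambda>z. Gamma z * Gamma (1 - z)) has_real_derivative
          - (pi\<^sup>2 * cos (pi * z) / (sin (pi * z))\<^sup>2)) (at z)"
  proof (rule has_field_derivative_transform_within)
    show "((\<lambda>z. pi / sin (pi * z)) has_real_derivative
          - (pi\<^sup>2 * cos (pi * z) / (sin (pi * z))\<^sup>2)) (at z)"
      using sin_pos by (auto intro!: derivative_eq_intros simp: power2_eq_square)
    show "0 < min z (1 - z)" using z by simp
    show "z \<in> UNIV" by simp
    show "pi / sin (pi * y) = Gamma y * Gamma (1 - y)" if "dist y z < min z (1 - z)" for y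
      using that by (subst Gamma_reflection_real) (auto simp: dist_real_def)
  qed
  ultimately have "Gamma z * Gamma (1 - z) * (Digamma z - Digamma (1 - z)) =
      - (pi\<^sup>2 * cos (pi * z) / (sin (pi * z))\<^sup>2)"
    by (rule DERIV_unique)
  then have eq: "pi / sin (pi * z) * (Digamma (1 - z) - Digamma z) =
      pi\<^sup>2 * cos (pi * z) / (sin (pi * z))\<^sup>2"
    using z by (simp add: Gamma_reflection_real algebra_simps)
  have "Digamma (1 - z) - Digamma z =
      sin (pi * z) / pi * (pi / sin (pi * z) * (Digamma (1 - z) - Digamma z))"
    using sin_pos by simp
  also have "\<dots> = pi * cot (pi * z)"
    unfolding eq using sin_pos by (simp add: cot_def power2_eq_square)
  finally show ?thesis .
qed

section \<open>Series over the poles\<close>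

lemma pole_eq: "pole n = pi\<^sup>2 * (real n + 1)\<^sup>2"
  by (simp add: pole_def power_mult_distrib)

lemma pole_ge: "pi\<^sup>2 \<le> pole n" "1 \<le> pole n"
proof -
  have "1 \<le> pi\<^sup>2" using pi_ge_two by (simp add: one_le_power)
  moreover show "pi\<^sup>2 \<le> pole n"
    by (auto simp: pole_def intro!: power_mono)
  ultimately show "1 \<le> pole n" by linarith
qed

lemma pole_term_nonneg: "y < pi\<^sup>2 \<Longrightarrow> 0 \<le> 1 / (pole n ^ k * (pole n - y))"
  using pole_ge[of n] by simp

lemma summable_pole_term:
  assumes y: "0 \<le> y" "y < pi\<^sup>2"
  shows "summable (\<lambda>n. 1 / (pole n ^ k * (pole n - y)))"
proof (rule summable_comparison_test')
  have "summable (\<lambda>n. inverse (real (Suc n) ^ 2))"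
    using inverse_power_summable[of 2, where 'a = real] by (subst summable_Suc_iff) simp
  then show "summable (\<lambda>n. 1 / (pi\<^sup>2 - y) * inverse (real (Suc n) ^ 2))"
    by (rule summable_mult)
  fix n :: nat
  \<comment> \<open>Comparison with inverse squares; the factor \<open>pole n ^ k\<close> is at
    least 1 and only helps.\<close>
  have "pole n - y \<ge> (pi\<^sup>2 - y) * (real n + 1)\<^sup>2"
  proof -
    have "y * 1 \<le> y * (real n + 1)\<^sup>2" using y by (intro mult_left_mono) auto
    then show ?thesis by (simp add: pole_eq algebra_simps)
  qed
  also have "pole n - y \<le> pole n ^ k * (pole n - y)"
    using pole_ge[of n] y mult_right_mono[of 1 "pole n ^ k" "pole n - y"] by (simp add: one_le_power)
  finally have "1 / (pole n ^ k * (pole n - y)) \<le> 1 / ((pi\<^sup>2 - y) * (real n + 1)\<^sup>2)"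
    using y pole_ge[of n] by (intro divide_left_mono mult_pos_pos zero_less_power) auto
  then show "norm (1 / (pole n ^ k * (pole n - y))) \<le> 1 / (pi\<^sup>2 - y) * inverse (real (Suc n) ^ 2)"
    using pole_term_nonneg[OF y(2)] by (simp add: field_simps)
qed

text \<open>Termwise \<open>1 / (N - y) = 1 / N + y / (N * (N - y))\<close>, one step of the
  geometric expansion in \<open>y\<close>.\<close>

lemma pole_sum_rec:
  assumes y: "0 \<le> y" "y < pi\<^sup>2"
  shows "pole_sum k y = pole_sum k 0 + y * pole_sum (Suc k) y"
proof -
  have "1 / (pole n ^ k * (pole n - y)) =
      1 / (pole n ^ k * (pole n - 0)) + y * (1 / (pole n ^ Suc k * (pole n - y)))" for n
  proof -
    have "pole n \<noteq> 0" "pole n - y \<noteq> 0" using y pole_ge[of n] by auto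
    then show ?thesis by (simp add: field_simps)
  qed
  then have "pole_sum k y =
      (\<Sum>n. 1 / (pole n ^ k * (pole n - 0)) + y * (1 / (pole n ^ Suc k * (pole n - y))))"
    unfolding pole_sum_def by presburger
  also have "\<dots> = pole_sum k 0 + (\<Sum>n. y * (1 / (pole n ^ Suc k * (pole n - y))))"
    unfolding pole_sum_def
    by (intro suminf_add[symmetric] summable_mult summable_pole_term y) auto
  also have "(\<Sum>n. y * (1 / (pole n ^ Suc k * (pole n - y)))) = y * pole_sum (Suc k) y"
    unfolding pole_sum_def by (intro suminf_mult summable_pole_term y)
  finally show ?thesis .
qed

text \<open>Every term grows with \<open>y\<close>, so the term \<open>n = 0\<close> alone bounds
  the growth from below; there \<open>pole 0 = pi ^ 2\<close>, and both differences in the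
  denominator are at most that.\<close>

lemma pole_sum_increment:
  assumes y: "0 \<le> y1" "y1 \<le> y2" "y2 < pi\<^sup>2"
  shows "(y2 - y1) / pi ^ (2 * k + 4) \<le> pole_sum k y2 - pole_sum k y1"
proof -
  let ?d = "\<lambda>n. 1 / (pole n ^ k * (pole n - y2)) - 1 / (pole n ^ k * (pole n - y1))"
  have s: "summable (\<lambda>n. 1 / (pole n ^ k * (pole n - y2)))"
    "summable (\<lambda>n. 1 / (pole n ^ k * (pole n - y1)))"
    using y by (auto intro!: summable_pole_term)
  have d: "?d n = (y2 - y1) / (pole n ^ k * (pole n - y1) * (pole n - y2))" for n
  proof -
    have "pole n \<noteq> 0" "pole n - y1 \<noteq> 0" "pole n - y2 \<noteq> 0" using y pole_ge[of n] by auto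
    then show ?thesis by (simp add: divide_simps)
  qed
  have pos: "0 \<le> ?d n" for n
    unfolding d using y pole_ge[of n] by simp
  have "pole 0 ^ k * (pole 0 - y1) * (pole 0 - y2) \<le> pole 0 ^ k * pole 0 * pole 0"
    using y pole_ge[of 0] by (intro mult_mono mult_nonneg_nonneg) auto
  also have "\<dots> = pi ^ (2 * k + 4)"
    by (simp add: pole_def power_add power_mult power2_eq_square power4_eq_xxxx)
  finally have "(y2 - y1) / pi ^ (2 * k + 4) \<le> ?d 0"
    unfolding d using y pole_ge[of 0] by (intro divide_left_mono mult_pos_pos) auto
  also have "\<dots> = (\<Sum>n\<in>{0}. ?d n)" by simp
  also have "\<dots> \<le> (\<Sum>n. ?d n)"
    using s pos by (intro sum_le_suminf summable_diff) auto
  also have "\<dots> = pole_sum k y2 - pole_sum k y1"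
    unfolding pole_sum_def using s by (simp add: suminf_diff)
  finally show ?thesis .
qed

lemma pole_sum_mono: "0 \<le> y1 \<Longrightarrow> y1 \<le> y2 \<Longrightarrow> y2 < pi\<^sup>2 \<Longrightarrow> pole_sum k y1 \<le> pole_sum k y2"
  using pole_sum_increment[of y1 y2 k] by (smt (verit) divide_nonneg_nonneg pi_ge_zero zero_le_power)

text \<open>Monotonicity gives the lower bound. The recursion gives the upper one, its remainder
  being controlled by the value at 1, a point below \<open>pi ^ 2\<close>.\<close>

lemma pole_sum_tendsto: "((\<lambda>x. pole_sum k (x\<^sup>2)) \<longlongrightarrow> pole_sum k 0) (at_right 0)"
proof (rule tendsto_sandwich)
  have pi2: "1 < pi\<^sup>2" using pi_gt3 by (simp add: one_less_power)
  have ev: "eventually (\<lambda>x::real. 0 < x \<and> x < 1) (at_right 0)"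
    by (simp add: eventually_at_right_less eventually_conj eventually_at_right_field) (use zero_less_one in blast)
  have small: "0 \<le> x\<^sup>2 \<and> x\<^sup>2 \<le> 1 \<and> x\<^sup>2 < pi\<^sup>2" if "0 < x" "x < 1" for x :: real
    using that pi2 power_le_one[of x 2] by auto
  show "eventually (\<lambda>x. pole_sum k 0 \<le> pole_sum k (x\<^sup>2)) (at_right 0)"
    using ev by eventually_elim (use small in \<open>auto intro!: pole_sum_mono\<close>)
  show "eventually (\<lambda>x. pole_sum k (x\<^sup>2) \<le> pole_sum k 0 + x\<^sup>2 * pole_sum (Suc k) 1) (at_right 0)"
    using ev
  proof eventually_elim
    case (elim x)
    then have "pole_sum (Suc k) (x\<^sup>2) \<le> pole_sum (Suc k) 1"
      using small[of x] pi2 by (intro pole_sum_mono) auto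
    then show ?case
      using pole_sum_rec[of "x\<^sup>2" k] small[of x] elim by (simp add: mult_left_mono)
  qed
  show "((\<lambda>x. pole_sum k 0 + x\<^sup>2 * pole_sum (Suc k) 1) \<longlongrightarrow> pole_sum k 0) (at_right 0)"
    by (auto intro!: tendsto_eq_intros)
qed simp

section \<open>Partial fractions of the cotangent\<close>

lemma cot_eq_pole_sum:
  assumes x: "0 < x" "x < pi"
  shows "cot x = 1 / x - 2 * x * pole_sum 0 (x\<^sup>2)"
proof -
  define z where "z = x / pi"
  have z: "0 < z" "z < 1" "pi * z = x" using x by (auto simp: z_def)
  let ?t = "\<lambda>n. 1 / (pole n - x\<^sup>2)"
  have x2: "x\<^sup>2 < pi\<^sup>2" using x by (simp add: power_strict_mono)
  \<comment> \<open>Pairing \<open>1 / (z + n + 1)\<close> with \<open>1 / (1 - z + n)\<close>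
    yields the pole terms; this shift by one leaves the boundary terms \<open>1 / z\<close> and
    \<open>1 / (z + m)\<close>.\<close>
  have partial: "(\<Sum>n<m. inverse (z + real n)) - (\<Sum>n<m. inverse (1 - z + real n)) =
     1 / z - 1 / (z + real m) - pi * (\<Sum>n<m. 2 * x * ?t n)" for m
  proof (induction m)
    case (Suc m)
    have ne: "z + real m \<noteq> 0" "z + real (Suc m) \<noteq> 0" "1 - z + real m \<noteq> 0"
      using z by auto
    have "pole m - x\<^sup>2 = pi\<^sup>2 * ((real m + 1 + z) * (1 - z + real m))"
      by (simp add: pole_def z(3)[symmetric] algebra_simps power2_eq_square)
    then have "pi * (2 * x * ?t m) = 2 * z / ((real m + 1 + z) * (1 - z + real m))"
      by (simp add: z(3)[symmetric] power2_eq_square)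
    also have "\<dots> = inverse (1 - z + real m) - 1 / (z + real (Suc m))"
      using ne by (simp add: field_simps)
    finally show ?case
      using Suc.IH by (simp add: algebra_simps inverse_eq_divide)
  qed simp
  \<comment> \<open>The logarithms in the two Digamma limits cancel.\<close>
  have "(\<lambda>m. (of_real (ln (real m)) - (\<Sum>n<m. inverse (1 - z + real n)))
            - (of_real (ln (real m)) - (\<Sum>n<m. inverse (z + real n))))
          \<longlonglongrightarrow> Digamma (1 - z) - Digamma z"
    using z by (intro tendsto_diff Digamma_LIMSEQ) auto
  then have "(\<lambda>m. 1 / z - 1 / (z + real m) - pi * (\<Sum>n<m. 2 * x * ?t n)) \<longlonglongrightarrow> pi * cot x"
    using z unfolding partial[symmetric] by (simp add: Digamma_reflection_real)
  moreover have "(\<lambda>m. 1 / z - 1 / (z + real m) - pi * (\<Sum>n<m. 2 * x * ?t n))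
       \<longlonglongrightarrow> 1 / z - 0 - pi * (2 * x * pole_sum 0 (x\<^sup>2))"
  proof (intro tendsto_intros)
    show "(\<lambda>m. 1 / (z + real m)) \<longlonglongrightarrow> 0"
      by real_asymp
    have "?t sums pole_sum 0 (x\<^sup>2)"
      using summable_sums[OF summable_pole_term[of "x\<^sup>2" 0]] x2 by (simp add: pole_sum_def)
    then have "(\<lambda>n. 2 * x * ?t n) sums (2 * x * pole_sum 0 (x\<^sup>2))"
      by (rule sums_mult)
    then show "(\<lambda>m. \<Sum>n<m. 2 * x * ?t n) \<longlonglongrightarrow> 2 * x * pole_sum 0 (x\<^sup>2)"
      by (simp add: sums_def)
  qed
  ultimately have "pi * cot x = 1 / z - pi * (2 * x * pole_sum 0 (x\<^sup>2))"
    using LIMSEQ_unique by fastforce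
  then have "pi * cot x = pi * (1 / x - 2 * x * pole_sum 0 (x\<^sup>2))"
    by (simp add: z_def right_diff_distrib)
  then show ?thesis
    by (simp only: mult_cancel_left pi_neq_zero simp_thms)
qed


section \<open>Taylor bounds and decimal bounds for pi\<close>

text \<open>The last term is the absolute remainder bound, so its sign is opposite to that in the
  sine series; likewise in \<open>sin_lower_taylor\<close>.\<close>

lemma sin_upper_taylor:
  assumes "0 \<le> (z::real)"
  shows "sin z \<le> z - z^3/6 + z^5/120 - z^7/5040 + z^9/362880 - z^11/39916800
     + z^13/6227020800 + z^15/1307674368000"
  using Maclaurin_sin_bound[of z 15] assms
  by (simp add: sin_coeff_def lessThan_nat_numeral lessThan_Suc fact_numeral abs_le_iff field_simps)

lemma sin_lower_taylor:
  assumes "0 \<le> (z::real)"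
  shows "z - z^3/6 + z^5/120 - z^7/5040 - z^9/362880 \<le> sin z"
  using Maclaurin_sin_bound[of z 9, THEN abs_le_D2] assms
  by (simp add: sin_coeff_def lessThan_nat_numeral lessThan_Suc fact_numeral)

lemma cos_lower_taylor:
  "1 - z\<^sup>2/2 + z^4/24 - z^6/720 + z^8/40320 - z^10/3628800 + z^12/479001600
     - z^14/87178291200 \<le> cos (z::real)"
proof -
  obtain t where "cos z = (\<Sum>m<14. cos_coeff m * z ^ m) + cos (t + 1/2 * real 14 * pi) / fact 14 * z ^ 14"
    using Maclaurin_cos_expansion[of z 14] by auto
  moreover have "- (z ^ 14 / 87178291200) \<le> cos (t + 1/2 * real 14 * pi) / fact 14 * z ^ 14"
    using mult_right_mono[OF cos_ge_minus_one[of "t + 1/2 * real 14 * pi"], of "z ^ 14 / 87178291200"]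
    by (simp add: fact_numeral)
  ultimately show ?thesis
    by (simp add: cos_coeff_def lessThan_nat_numeral lessThan_Suc fact_numeral)
qed

text \<open>Compares sines with \<open>sin (pi / 6) = 1 / 2\<close>. The precision serves the final
  estimate, where \<open>b\<close> is less than 1e-7 below 0.001210.\<close>

lemma pi_lower: "3.141592 < pi"
proof -
  let ?x = "3.141592 / 6 :: real"
  have "sin ?x < sin (pi / 6)"
    using sin_upper_taylor[of ?x] by (simp add: sin_30 power_divide)
  then have "?x < pi / 6"
    using pi_gt3 pi_less_4 by (subst (asm) sin_mono_less_eq) auto
  then show ?thesis by simp
qed

lemma pi_upper: "pi < 3.1416"
proof -
  let ?x = "3.1416 / 6 :: real"
  have "sin (pi / 6) < sin ?x"
    using sin_lower_taylor[of ?x] by (simp add: sin_30 power_divide)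
  then have "pi / 6 < ?x"
    using pi_gt3 pi_less_4 by (subst (asm) sin_mono_less_eq) auto
  then show ?thesis by simp
qed

section \<open>The gap quotient and the slope of the sine remainder\<close>

text \<open>
  What remains of \<open>gap_quot\<close> below once the cotangent is expanded up to its third-order tail; the
  numerator is a Taylor remainder of \<open>sin (2 * x) / 2\<close>.
\<close>
definition sin_tail :: "real \<Rightarrow> real" where
  "sin_tail x = (sin (2 * x) / 2 - x + 2 / 3 * x ^ 3 - 2 / 15 * x ^ 5 + 4 / 315 * x ^ 7) / x ^ 9"

text \<open>The function \<open>g\<close> of the overview. Division by \<open>tan x\<close> leaves
  only the cotangent, so it stays regular at \<open>pi / 2\<close>.\<close>

definition gap_quot :: "real \<Rightarrow> real" where
  "gap_quot x = (sin (2 * x) / 2 + x - 2 * x\<^sup>2 * cot x - 8 / 45 * x ^ 5 + 8 / 945 * x ^ 7) / x ^ 9"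

lemma wilker_minus_bound:
  assumes "0 < x" "x < pi / 2"
  shows "wilker x - wilker_bound c x = x ^ 7 * tan x * (gap_quot x - c)"
proof -
  have "sin x > 0" "cos x > 0"
    using assms by (auto intro!: sin_gt_zero cos_gt_zero)
  then show ?thesis
    using assms
    by (simp add: wilker_def wilker_bound_def gap_quot_def tan_def cot_def sin_double
        divide_simps) (simp add: algebra_simps eval_nat_numeral)
qed

text \<open>
  The constant is \<open>2 ^ 10 / 11!\<close>, the absolute value of the \<open>x\<^sup>2\<close>-coefficient of
  \<open>sin_tail x = 2 ^ 8 / 9! - 2 ^ 10 / 11! * x\<^sup>2 + \<dots>\<close>.
\<close>
lemma sin_tail_decrease:
  assumes "0 < x1" "x1 \<le> x2" "x2 \<le> pi / 2"
  shows "sin_tail x1 - sin_tail x2 \<le> 1024 / 39916800 * (x2\<^sup>2 - x1\<^sup>2)"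
proof -
  have "sin_tail x1 + 1024 / 39916800 * x1\<^sup>2 \<le> sin_tail x2 + 1024 / 39916800 * x2\<^sup>2"
  proof (rule DERIV_nonneg_imp_nondecreasing[OF assms(2)])
    fix x assume x: "x1 \<le> x" "x \<le> x2"
    then have x0: "0 < x" and xu: "x \<le> 1.6" using assms pi_upper by auto
    let ?N = "sin (2 * x) / 2 - x + 2 / 3 * x ^ 3 - 2 / 15 * x ^ 5 + 4 / 315 * x ^ 7"
    let ?N' = "cos (2 * x) - 1 + 2 * x ^ 2 - 2 / 3 * x ^ 4 + 4 / 45 * x ^ 6"
    let ?D = "(x * ?N' - 9 * ?N + 2048 / 39916800 * x ^ 11) / x ^ 10"
    have "((\<lambda>x. sin_tail x + 1024 / 39916800 * x\<^sup>2) has_real_derivative ?D) (at x)"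
    proof -
      have N: "((\<lambda>x. sin (2 * x) / 2 - x + 2 / 3 * x ^ 3 - 2 / 15 * x ^ 5 + 4 / 315 * x ^ 7)
          has_real_derivative ?N') (at x)"
        by (auto intro!: derivative_eq_intros)
      have "((\<lambda>x. x ^ 9) has_real_derivative 9 * x ^ 8) (at x)"
        by (auto intro!: derivative_eq_intros)
      from DERIV_divide[OF N this]
      have "((\<lambda>x. sin_tail x + 1024 / 39916800 * x\<^sup>2) has_real_derivative
          (?N' * x ^ 9 - ?N * (9 * x ^ 8)) / (x ^ 9 * x ^ 9) + 1024 / 39916800 * (2 * x)) (at x)"
        unfolding sin_tail_def using x0 by (auto intro!: derivative_eq_intros)
      moreover have "(u * x ^ 9 - v * (9 * x ^ 8)) / (x ^ 9 * x ^ 9) + 1024 / 39916800 * (2 * x) =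
          (x * u - 9 * v + 2048 / 39916800 * x ^ 11) / x ^ 10" for u v
        using x0 by (simp add: divide_simps) (simp add: algebra_simps eval_nat_numeral)
      ultimately show ?thesis by simp
    qed
    moreover have "0 \<le> x * ?N' - 9 * ?N + 2048 / 39916800 * x ^ 11"
    proof -
      let ?C = "1 - (2*x)\<^sup>2/2 + (2*x)^4/24 - (2*x)^6/720 + (2*x)^8/40320 - (2*x)^10/3628800
          + (2*x)^12/479001600 - (2*x)^14/87178291200"
      let ?S = "2*x - (2*x)^3/6 + (2*x)^5/120 - (2*x)^7/5040 + (2*x)^9/362880
          - (2*x)^11/39916800 + (2*x)^13/6227020800 + (2*x)^15/1307674368000"
      \<comment> \<open>Powers up to \<open>x ^ 9\<close> cancel, and the added term cancels
        \<open>x ^ 11\<close>. What \<open>?C\<close> and \<open>?S\<close> leave has coefficients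
        \<open>4 * 2 ^ 12 / 13!\<close> and \<open>- 24 * 2 ^ 14 / 15!\<close>.\<close>
      have "x * ?N' - 9 * ?N + 2048 / 39916800 * x ^ 11 =
          x * (cos (2 * x) - ?C) + 9 / 2 * (?S - sin (2 * x))
          + x ^ 13 * (16384 / 6227020800 - 393216 / 1307674368000 * x\<^sup>2)"
        by (simp add: algebra_simps eval_nat_numeral)
      moreover have "0 \<le> x * (cos (2 * x) - ?C)"
        using cos_lower_taylor[of "2 * x"] x0 by (intro mult_nonneg_nonneg) auto
      moreover have "0 \<le> 9 / 2 * (?S - sin (2 * x))"
        using sin_upper_taylor[of "2 * x"] x0 by (intro mult_nonneg_nonneg) auto
      moreover have "0 \<le> x ^ 13 * (16384 / 6227020800 - 393216 / 1307674368000 * x\<^sup>2)"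
        using x0 power_mono[OF xu, of 2] by (intro mult_nonneg_nonneg) (auto simp: power_divide)
      ultimately show ?thesis by linarith
    qed
    then have "0 \<le> ?D" using x0 by simp
    ultimately show "\<exists>y. ((\<lambda>x. sin_tail x + 1024 / 39916800 * x\<^sup>2) has_real_derivative y) (at x) \<and> 0 \<le> y"
      by blast
  qed
  then show ?thesis by (simp add: algebra_simps)
qed

section \<open>Pole sums at zero and the splitting of the gap quotient\<close>

lemma pole_sum_0_eq:
  assumes "0 < x" "x < pi"
  shows "pole_sum 0 (x\<^sup>2) = (1 / x - cot x) / (2 * x)"
  using cot_eq_pole_sum[OF assms] assms by (simp add: field_simps)

lemma pole_sum_Suc_eq:
  assumes "0 < x" "x < pi"
  shows "pole_sum (Suc k) (x\<^sup>2) = (pole_sum k (x\<^sup>2) - pole_sum k 0) / x\<^sup>2"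
proof -
  have "x\<^sup>2 < pi\<^sup>2" using assms by (simp add: power_strict_mono)
  then show ?thesis
    using pole_sum_rec[of "x\<^sup>2" k] assms by (simp add: field_simps)
qed

text \<open>
  The constants \<open>pole_sum k 0\<close> are \<open>\<zeta>(2 * k + 2) / pi ^ (2 * k + 2)\<close>; they are read off the
  behaviour of the cotangent at 0.
\<close>
lemma pole_sum_at_0_eqI:
  assumes "\<And>x. 0 < x \<Longrightarrow> x < pi \<Longrightarrow> pole_sum k (x\<^sup>2) = f x" and "(f \<longlongrightarrow> c) (at_right 0)"
  shows "pole_sum k 0 = c"
proof -
  have "eventually (\<lambda>x. pole_sum k (x\<^sup>2) = f x) (at_right 0)"
    using assms(1) eventually_at_right_real[OF pi_gt_zero] by (auto elim: eventually_mono)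
  then have "(f \<longlongrightarrow> pole_sum k 0) (at_right 0)"
    using pole_sum_tendsto[of k] by (rule Lim_transform_eventually[rotated])
  then show ?thesis
    using assms(2) tendsto_unique trivial_limit_at_right_real by blast
qed

lemma pole_sum_0_0: "pole_sum 0 0 = 1 / 6"
proof (rule pole_sum_at_0_eqI)
  show "((\<lambda>x::real. (1 / x - cot x) / (2 * x)) \<longlongrightarrow> 1 / 6) (at_right 0)"
    unfolding cot_def by real_asymp
qed (rule pole_sum_0_eq)

lemma pole_sum_1_0: "pole_sum (Suc 0) 0 = 1 / 90"
proof (rule pole_sum_at_0_eqI)
  show "((\<lambda>x::real. ((1 / x - cot x) / (2 * x) - 1 / 6) / x\<^sup>2) \<longlongrightarrow> 1 / 90) (at_right 0)"
    unfolding cot_def by real_asymp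
qed (simp add: pole_sum_Suc_eq pole_sum_0_eq pole_sum_0_0)

lemma pole_sum_2_0: "pole_sum (Suc (Suc 0)) 0 = 1 / 945"
proof (rule pole_sum_at_0_eqI)
  show "((\<lambda>x::real. (((1 / x - cot x) / (2 * x) - 1 / 6) / x\<^sup>2 - 1 / 90) / x\<^sup>2) \<longlongrightarrow> 1 / 945) (at_right 0)"
    unfolding cot_def by real_asymp
qed (simp add: pole_sum_Suc_eq pole_sum_0_eq pole_sum_0_0 pole_sum_1_0)

text \<open>Three recursion steps turn \<open>- 2 * x ^ 2 * cot x\<close> into a polynomial plus
  \<open>4 * x ^ 9 * pole_sum 3 (x ^ 2)\<close>. With \<open>8 / 45\<close> and
  \<open>8 / 945\<close> the polynomial parts merge into the Taylor coefficients of
  \<open>sin (2 * x) / 2\<close>.\<close>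

lemma gap_quot_eq:
  assumes x: "0 < x" "x < pi"
  shows "gap_quot x = 4 * pole_sum 3 (x\<^sup>2) + sin_tail x"
proof -
  have x2: "0 \<le> x\<^sup>2" "x\<^sup>2 < pi\<^sup>2" using x by (auto simp: power_strict_mono)
  have eq: "pole_sum 0 (x\<^sup>2) = 1 / 6 + x\<^sup>2 * (1 / 90 + x\<^sup>2 * (1 / 945 + x\<^sup>2 * pole_sum 3 (x\<^sup>2)))"
    using pole_sum_rec[OF x2, of 0] pole_sum_rec[OF x2, of "Suc 0"]
      pole_sum_rec[OF x2, of "Suc (Suc 0)"]
    by (simp add: pole_sum_0_0 pole_sum_1_0 pole_sum_2_0 numeral_3_eq_3)
  show ?thesis
    using x unfolding gap_quot_def sin_tail_def cot_eq_pole_sum[OF x] eq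
    by (simp add: divide_simps) (simp add: algebra_simps eval_nat_numeral)
qed

section \<open>Monotonicity and end values\<close>

lemma gap_quot_strict_mono:
  assumes x: "0 < x1" "x1 < x2" "x2 \<le> pi / 2"
  shows "gap_quot x1 < gap_quot x2"
proof -
  have lt: "x1\<^sup>2 < x2\<^sup>2" "x2\<^sup>2 < pi\<^sup>2" using x pi_gt_zero
    by (auto intro!: power_strict_mono simp del: pi_gt_zero)
  have "(x2\<^sup>2 - x1\<^sup>2) / pi ^ 10 \<le> pole_sum 3 (x2\<^sup>2) - pole_sum 3 (x1\<^sup>2)"
    using pole_sum_increment[of "x1\<^sup>2" "x2\<^sup>2" 3] lt by simp
  moreover have "1024 / 39916800 * (x2\<^sup>2 - x1\<^sup>2) < 4 * ((x2\<^sup>2 - x1\<^sup>2) / pi ^ 10)"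
  proof -
    \<comment> \<open>The crude 3.2 is enough: \<open>4 / 3.2 ^ 10\<close> is about 3.5e-5, against
      2.6e-5.\<close>
    have "pi ^ 10 \<le> 3.2 ^ 10" using pi_upper by (intro power_mono) auto
    then have "1024 / 39916800 < 4 / pi ^ 10" by (simp add: field_simps power_divide)
    from mult_strict_right_mono[OF this, of "x2\<^sup>2 - x1\<^sup>2"] show ?thesis using lt by simp
  qed
  moreover have "sin_tail x1 - sin_tail x2 \<le> 1024 / 39916800 * (x2\<^sup>2 - x1\<^sup>2)"
    using x by (intro sin_tail_decrease) auto
  moreover have "gap_quot x1 = 4 * pole_sum 3 (x1\<^sup>2) + sin_tail x1"
    "gap_quot x2 = 4 * pole_sum 3 (x2\<^sup>2) + sin_tail x2"
    using x pi_gt_zero by (auto intro!: gap_quot_eq simp del: pi_gt_zero)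
  ultimately show ?thesis by argo
qed

text \<open>The limit is \<open>4 * pole_sum 3 0 = 4 / 9450\<close> plus the leading coefficient
  \<open>2 ^ 8 / 9!\<close> of \<open>sin_tail\<close>.\<close>

lemma gap_quot_tendsto_0: "(gap_quot \<longlongrightarrow> 16 / 14175) (at_right 0)"
  unfolding gap_quot_def[abs_def] cot_def by real_asymp

lemma gap_quot_pi_half:
  "gap_quot (pi / 2) = (241920 - 2688 * pi ^ 4 + 32 * pi ^ 6) / (945 * pi ^ 8)"
  by (simp add: gap_quot_def cot_def divide_simps) (simp add: algebra_simps eval_nat_numeral)

lemma gap_quot_tendsto_pi_half: "(gap_quot \<longlongrightarrow> gap_quot (pi / 2)) (at_left (pi / 2))"
  unfolding gap_quot_def[abs_def] cot_def by (intro tendsto_intros) auto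

lemma wilker_less_bound_iff:
  assumes "0 < x" "x < pi / 2"
  shows "wilker x < wilker_bound c x \<longleftrightarrow> gap_quot x < c"
    and "wilker_bound c x < wilker x \<longleftrightarrow> c < gap_quot x"
proof -
  have "0 < x ^ 7 * tan x" using assms by (simp add: tan_gt_zero)
  then have "x ^ 7 * tan x * (gap_quot x - c) < 0 \<longleftrightarrow> gap_quot x < c"
    and "0 < x ^ 7 * tan x * (gap_quot x - c) \<longleftrightarrow> c < gap_quot x"
    by (simp_all only: mult_less_0_iff zero_less_mult_iff) auto
  then show "wilker x < wilker_bound c x \<longleftrightarrow> gap_quot x < c"
    and "wilker_bound c x < wilker x \<longleftrightarrow> c < gap_quot x"
    unfolding wilker_minus_bound[OF assms, symmetric] by auto
qed

section \<open>Optimality and decimal values of the constants\<close>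

lemma best_lower_constant: "best_lower_constant (16 / 14175)"
  unfolding best_lower_constant_def
proof (intro conjI ballI allI impI)
  fix x :: real assume x: "x \<in> {0<..<pi / 2}"
  \<comment> \<open>The limit gives only a weak inequality; applying it at \<open>x / 2\<close>
    leaves room for a strict one at \<open>x\<close>.\<close>
  have "eventually (\<lambda>y. gap_quot y \<le> gap_quot (x / 2)) (at_right 0)"
    using eventually_at_right_real[of 0 "x / 2"] x
    by (auto elim!: eventually_mono intro!: less_imp_le gap_quot_strict_mono)
  then have "16 / 14175 \<le> gap_quot (x / 2)"
    using tendsto_upperbound[OF gap_quot_tendsto_0] by simp
  also have "\<dots> < gap_quot x" using x by (intro gap_quot_strict_mono) auto
  finally show "wilker_bound (16 / 14175) x < wilker x"
    using x by (simp add: wilker_less_bound_iff)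
next
  fix a' :: real assume "16 / 14175 < a'"
  then have "eventually (\<lambda>x. gap_quot x < a' \<and> x \<in> {0<..<pi / 2}) (at_right 0)"
    by (intro eventually_conj order_tendstoD(2)[OF gap_quot_tendsto_0] eventually_at_right_real) auto
  then obtain x where "gap_quot x < a'" "x \<in> {0<..<pi / 2}"
    using eventually_happens trivial_limit_at_right_real by blast
  then show "\<exists>x\<in>{0<..<pi / 2}. \<not> wilker_bound a' x < wilker x"
    by (intro bexI[of _ x]) (auto simp: wilker_less_bound_iff)
qed

text \<open>Strict monotonicity reaches \<open>pi / 2\<close> itself, so the bound is immediate;
  left continuity there gives optimality.\<close>

lemma best_upper_constant: "best_upper_constant (gap_quot (pi / 2))"
  unfolding best_upper_constant_def
proof (intro conjI ballI allI impI)
  fix x :: real assume "x \<in> {0<..<pi / 2}"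
  then show "wilker x < wilker_bound (gap_quot (pi / 2)) x"
    by (auto simp: wilker_less_bound_iff intro!: gap_quot_strict_mono)
next
  fix b' assume "b' < gap_quot (pi / 2)"
  then have "eventually (\<lambda>x. b' < gap_quot x \<and> x \<in> {0<..<pi / 2}) (at_left (pi / 2))"
    by (intro eventually_conj order_tendstoD(1)[OF gap_quot_tendsto_pi_half] eventually_at_left_real) auto
  then obtain x where "b' < gap_quot x" "x \<in> {0<..<pi / 2}"
    using eventually_happens trivial_limit_at_left_real by blast
  then show "\<exists>x\<in>{0<..<pi / 2}. \<not> wilker x < wilker_bound b' x"
    by (intro bexI[of _ x]) (auto simp: wilker_less_bound_iff)
qed

theorem theorem3p3:
  fixes a b :: real
  assumes "a = 16 / 14175"
    and "b = (241920 - 2688 * pi ^ 4 + 32 * pi ^ 6) / (945 * pi ^ 8)"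
  shows "best_lower_constant a \<and> best_upper_constant b \<and>
    0.001128 \<le> a \<and> a < 0.001129 \<and> 0.001209 \<le> b \<and> b < 0.001210"
proof -
  have b: "b = gap_quot (pi / 2)" by (simp add: assms gap_quot_pi_half)
  \<comment> \<open>With denominators cleared, both bounds on \<open>b\<close> are linear in
    \<open>p ^ 2\<close>, \<open>p ^ 3\<close> and \<open>p ^ 4\<close>, which are enclosed
    separately.\<close>
  define p where "p = pi\<^sup>2"
  have p: "3.141592\<^sup>2 < p" "p < 3.1416\<^sup>2"
    unfolding p_def using pi_lower pi_upper by (auto intro!: power_strict_mono)
  have bp: "b = (241920 - 2688 * p\<^sup>2 + 32 * p ^ 3) / (945 * p ^ 4)"
    by (simp add: assms p_def flip: power_mult)
  have p2: "(3.141592\<^sup>2)\<^sup>2 < p\<^sup>2" "p\<^sup>2 < (3.1416\<^sup>2)\<^sup>2"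
    by (rule power_strict_mono[OF p(1)] power_strict_mono[OF p(2)]; simp add: p_def)+
  have p3: "(3.141592\<^sup>2)^3 < p^3" "p^3 < (3.1416\<^sup>2)^3"
    by (rule power_strict_mono[OF p(1)] power_strict_mono[OF p(2)]; simp add: p_def)+
  have p4: "(3.141592\<^sup>2)^4 < p^4" "p^4 < (3.1416\<^sup>2)^4"
    by (rule power_strict_mono[OF p(1)] power_strict_mono[OF p(2)]; simp add: p_def)+
  have "0.001209 * (945 * p ^ 4) \<le> 241920 - 2688 * p\<^sup>2 + 32 * p ^ 3"
    using p2 p3 p4 by (simp add: power_divide)
  moreover have "241920 - 2688 * p\<^sup>2 + 32 * p ^ 3 < 0.001210 * (945 * p ^ 4)"
    using p2 p3 p4 by (simp add: power_divide)
  moreover have "0 < 945 * p ^ 4" by (simp add: p_def)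
  ultimately have "0.001209 \<le> b" "b < 0.001210"
    unfolding bp by (simp_all only: pos_le_divide_eq pos_divide_less_eq)
  then show ?thesis
    using best_lower_constant best_upper_constant unfolding b[symmetric] assms(1) by simp
qed

end
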